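(* Suppose the set of admissible scheduling trajectories $\mathscr{P}_{[1,L]}$ has the quadratic description (with symmetric matrix $M_P$) given in the context, and let $\Pi_H$, $F(\bar p_{[1,L]})$, $F_3$, $F_4$, $F_5$ be constructed from the data as in the context. If there exist $\mu\in\mathbb{R}$ and $\lambda\ge0$ such that $$\begin{bmatrix} \mu F_4^\top F_4 & -\mu F_4^\top F_3 \\ -\mu F_3^\top F_4 & \mu F_3^\top F_3+\Pi_H \end{bmatrix}-\lambda\begin{bmatrix} I & 0 \\ 0 & F_5 \end{bmatrix}^\top M_P\begin{bmatrix} I & 0 \\ 0 & F_5 \end{bmatrix}\succeq0,$$ then, for every $\bar p_{[1,L]}\in\mathscr{P}_{[1,L]}$, $$g^\top\Pi_H\,g\ge0\quad\text{for all } g\in\mathbb{R}^{N-L+1}\text{ with }F(\bar p_{[1,L]})\,g=0.$$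
   Context: **Data.** Let $1\le L<N$ and $1\le\tau<L$ be integers, and let $\{u_k,p_k,y_k\}_{k=1}^N$, with $u_k\in\mathbb{R}^{n_\mathrm{u}}$, $p_k\in\mathbb{P}\subseteq\mathbb{R}^{n_\mathrm{p}}$ ($\mathbb{P}$ convex and compact), $y_k\in\mathbb{R}^{n_\mathrm{y}}$, be a data set measured from a linear parameter-varying system of the form $y_k+\sum_{i=1}^{n_\mathrm{a}}a_i(p_{k-i})y_{k-i}=\sum_{i=0}^{n_\mathrm{b}}b_i(p_{k-i})u_{k-i}$ with $a_i,b_i$ affine functions. **Supply rate.** $Q=Q^\top\in\mathbb{R}^{n_\mathrm{u}\times n_\mathrm{u}}$, $S\in\mathbb{R}^{n_\mathrm{u}\times n_\mathrm{y}}$, $R=R^\top\in\mathbb{R}^{n_\mathrm{y}\times n_\mathrm{y}}$ are given. **Data matrices.** For a sequence $w_{[1,N]}$, $\mathcal{H}_L(w_{[1,N]})$ is the block Hankel matrix with $L$ block rows and $N-L+1$ columns whose $(i,j)$ block is $w_{i+j-1}$. Write $u^{\mathtt p}_{[1,N]}=\{p_k\otimes u_k\}_{k=1}^N$, $y^{\mathtt p}_{[1,N]}=\{p_k\otimes y_k\}_{k=1}^N$ (data scheduling $p$). For a trajectory $\bar p_{[1,L]}=(\bar p_1,\dots,\bar p_L)$ let $\bar{\mathcal P}^{n}=\mathrm{blkdiag}_{i=1}^{L}(\bar p_i\otimes I_n)$ and $\bar{\mathcal P}^{n_\mathrm{u},n_\mathrm{y}}=\begin{bmatrix} \bar{\mathcal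 P}^{n_\mathrm{u}} & 0 \\ 0 & \bar{\mathcal P}^{n_\mathrm{y}} \end{bmatrix}$. Let $V_\tau$ be the selection matrix mapping the stacked vector $(\bar u_1,\dots,\bar u_L,\bar y_1,\dots,\bar y_L)$ to $(\bar u_1,\dots,\bar u_\tau,\bar y_1,\dots,\bar y_\tau)$. Define $$F_5=\begin{bmatrix} \mathcal{H}_L(u_{[1,N]}) \\ \mathcal{H}_L(y_{[1,N]}) \end{bmatrix},\quad \Pi_L=\begin{bmatrix} I_L\otimes Q & I_L\otimes S \\ I_L\otimes S^\top & I_L\otimes R \end{bmatrix},\quad \Pi_H=F_5^\top\Pi_LF_5,$$ $$F_1=V_\tau F_5,\quad F_3=\begin{bmatrix} F_1 \\ \mathcal{H}_L(u^{\mathtt p}_{[1,N]}) \\ \mathcal{H}_L(y^{\mathtt p}_{[1,N]}) \end{bmatrix},\quad F_4=\begin{bmatrix} 0 & 0 \\ I & 0 \\ 0 & I \end{bmatrix},$$ with block sizes of $F_4$ compatible with $F_3$ and $\bar{\mathcal P}^{n_\mathrm{u},n_\mathrm{y}}$, and $$F(\bar p_{[1,L]})=F_3-F_4\,\bar{\mathcal P}^{n_\mathrm{u},n_\mathrm{y}}F_5=\begin{bmatrix} F_1 \\ \mathcal{H}_L(u^{\mathtt p}_{[1,N]})-\bar{\mathcal P}^{n_\mathrm{u}}\mathcal{H}_L(u_{[1,N]}) \\ \mathcal{H}_L(y^{\mathtt p}_{[1,N]})-\bar{\mathcal P}^{n_\mathrm{y}}\mathcal{H}_L(y_{[1,N]})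 \end{bmatrix}.$$ **Quadratic description of $\mathscr{P}_{[1,L]}$.** The scheduling trajectories $\bar p_{[1,L]}$ vary around a nominal trajectory $\breve p_{[1,L]}$ such that $\lVert\bar p_k-\breve p_k\rVert_W\le p_{\max}$ for all $k=1,\dots,L$ with some $p_{\max}>0$ (where $W$ specifies the norm), and $\mathscr{P}_{[1,L]}$ is described by $$\mathscr{P}_{[1,L]}=\left\{\bar p_{[1,L]}\in\mathbb{P}^L\ \middle|\ \begin{bmatrix} \bar{\mathcal P}^{n_\mathrm{u},n_\mathrm{y}} \\ I \end{bmatrix}^\top M_P\begin{bmatrix} \bar{\mathcal P}^{n_\mathrm{u},n_\mathrm{y}} \\ I \end{bmatrix}\succeq0\right\}$$ for a symmetric matrix $M_P$. For instance, for the Euclidean norm ($W=2$), $M_P=\begin{bmatrix} -I & \breve{\mathcal P} \\ \breve{\mathcal P}^\top & p_{\max}^2I-\breve{\mathcal P}^\top\breve{\mathcal P} \end{bmatrix}$, where $\breve{\mathcal P}$ is $\bar{\mathcal P}^{n_\mathrm{u},n_\mathrm{y}}$ evaluated at $\breve p_{[1,L]}$. *)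

theory Defs
  imports "HOL-Analysis.Abstract_Euclidean_Space" "Jordan_Normal_Form.Matrix"
begin

text \<open>Names and infix symbols for vectors and matrices refer to the dimension-carrying types of
  \<^theory>\<open>Jordan_Normal_Form.Matrix\<close>, because the sizes of all matrices below depend on the
  natural numbers \<open>L\<close>, \<open>N\<close>, \<open>\<tau>\<close> and the signal dimensions.\<close>

hide_type (open) Finite_Cartesian_Product.vec
hide_const (open) Finite_Cartesian_Product.vec Finite_Cartesian_Product.mat
unbundle no vec_syntax and no inner_syntax

section \<open>Convexity, compactness and norms on \<open>\<real>\<^sup>n\<close>\<close>

definition convex_vecs :: "real vec set \<Rightarrow> bool" where
  "convex_vecs X \<longleftrightarrow>
    (\<forall>x\<in>X. \<forall>y\<in>X. \<forall>s\<ge>0. \<forall>t\<ge>0. s + t = 1 \<longrightarrow> s \<cdot>\<^sub>v x + t \<cdot>\<^sub>v y \<in> X)"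

text \<open>The points of \<^const>\<open>Euclidean_space\<close> \<open>n\<close> are the real sequences that vanish from index \<open>n\<close> on.\<close>

definition compact_vecs :: "nat \<Rightarrow> real vec set \<Rightarrow> bool" where
  "compact_vecs n X \<longleftrightarrow> X \<subseteq> carrier_vec n \<and>
    compactin (Euclidean_space n) ((\<lambda>x i. if i < n then x $ i else 0) ` X)"

definition norm_on_vecs :: "nat \<Rightarrow> (real vec \<Rightarrow> real) \<Rightarrow> bool" where
  "norm_on_vecs n f \<longleftrightarrow>
    (\<forall>x\<in>carrier_vec n. 0 \<le> f x \<and> (f x = 0 \<longleftrightarrow> x = 0\<^sub>v n)) \<and>
    (\<forall>x\<in>carrier_vec n. \<forall>c. f (c \<cdot>\<^sub>v x) = \<bar>c\<bar> * f x) \<and>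
    (\<forall>x\<in>carrier_vec n. \<forall>y\<in>carrier_vec n. f (x + y) \<le> f x + f y)"

section \<open>Symmetric and positive semidefinite matrices, Kronecker products\<close>

definition symmetric_mat :: "nat \<Rightarrow> real mat \<Rightarrow> bool" where
  "symmetric_mat n A \<longleftrightarrow> A \<in> carrier_mat n n \<and> transpose_mat A = A"

definition psd_mat :: "nat \<Rightarrow> real mat \<Rightarrow> bool" where
  "psd_mat n A \<longleftrightarrow> symmetric_mat n A \<and> (\<forall>x\<in>carrier_vec n. 0 \<le> x \<bullet> (A *\<^sub>v x))"

definition kron_mat :: "real mat \<Rightarrow> real mat \<Rightarrow> real mat" where
  "kron_mat A B = mat (dim_row A * dim_row B) (dim_col A * dim_col B)
    (\<lambda>(i, j). A $$ (i div dim_row B, j div dim_col B) * B $$ (i mod dim_row B, j mod dim_col B))"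

definition kron_vec :: "real vec \<Rightarrow> real vec \<Rightarrow> real vec" where
  "kron_vec x y = vec (dim_vec x * dim_vec y) (\<lambda>i. x $ (i div dim_vec y) * y $ (i mod dim_vec y))"

definition col_mat :: "real vec \<Rightarrow> real mat" where
  "col_mat x = mat_of_cols (dim_vec x) [x]"

section \<open>Data from a linear parameter-varying system\<close>

definition affine_mat_fun :: "nat \<Rightarrow> nat \<Rightarrow> nat \<Rightarrow> (real vec \<Rightarrow> real mat) \<Rightarrow> bool" where
  "affine_mat_fun n nr nc A \<longleftrightarrow> (\<exists>C :: nat \<Rightarrow> real mat. \<forall>q\<in>carrier_vec n.
    A q = mat nr nc (\<lambda>rs. C 0 $$ rs + (\<Sum>j<n. q $ j * C (Suc j) $$ rs)))"

text \<open>The data are indexed by \<open>1, \<dots>, N\<close>.  The difference equation is imposed at all instants \<open>k\<close>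
  for which every sample that occurs in it belongs to the data.  This is implied by the data
  being a window of a longer system trajectory.\<close>

definition lpv_data ::
  "nat \<Rightarrow> nat \<Rightarrow> (nat \<Rightarrow> real vec \<Rightarrow> real mat) \<Rightarrow> (nat \<Rightarrow> real vec \<Rightarrow> real mat) \<Rightarrow>
   nat \<Rightarrow> nat \<Rightarrow> (nat \<Rightarrow> real vec) \<Rightarrow> (nat \<Rightarrow> real vec) \<Rightarrow> (nat \<Rightarrow> real vec) \<Rightarrow> bool" where
  "lpv_data na nb a b ny N u p y \<longleftrightarrow> (\<forall>k. max na nb < k \<and> k \<le> N \<longrightarrow>
    y k + finsum_vec TYPE(real) ny (\<lambda>i. a i (p (k - i)) *\<^sub>v y (k - i)) {1..na} =
    finsum_vec TYPE(real) ny (\<lambda>i. b i (p (k - i)) *\<^sub>v u (k - i)) {0..nb})"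

section \<open>Data matrices\<close>

text \<open>Block Hankel matrix of a sequence of vectors of dimension \<open>n\<close> with indices \<open>1, \<dots>, N\<close>.
  The zero-based entry \<open>(r, c)\<close> lies in the one-based block \<open>(r div n + 1, c + 1)\<close>.\<close>

definition hankel :: "nat \<Rightarrow> nat \<Rightarrow> nat \<Rightarrow> (nat \<Rightarrow> real vec) \<Rightarrow> real mat" where
  "hankel L N n w = mat (L * n) (N - L + 1) (\<lambda>(r, c). w (r div n + c + 1) $ (r mod n))"

definition mat_F5 ::
  "nat \<Rightarrow> nat \<Rightarrow> nat \<Rightarrow> nat \<Rightarrow> (nat \<Rightarrow> real vec) \<Rightarrow> (nat \<Rightarrow> real vec) \<Rightarrow> real mat" where
  "mat_F5 L N nu ny u y = hankel L N nu u @\<^sub>r hankel L N ny y"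

definition supply_mat :: "nat \<Rightarrow> real mat \<Rightarrow> real mat \<Rightarrow> real mat \<Rightarrow> real mat" where
  "supply_mat L Q S R = four_block_mat
    (kron_mat (1\<^sub>m L) Q) (kron_mat (1\<^sub>m L) S)
    (kron_mat (1\<^sub>m L) (transpose_mat S)) (kron_mat (1\<^sub>m L) R)"

definition mat_PiH ::
  "nat \<Rightarrow> nat \<Rightarrow> nat \<Rightarrow> nat \<Rightarrow> (nat \<Rightarrow> real vec) \<Rightarrow> (nat \<Rightarrow> real vec) \<Rightarrow>
   real mat \<Rightarrow> real mat \<Rightarrow> real mat \<Rightarrow> real mat" where
  "mat_PiH L N nu ny u y Q S R =
    transpose_mat (mat_F5 L N nu ny u y) * supply_mat L Q S R * mat_F5 L N nu ny u y"

definition select_first :: "nat \<Rightarrow> nat \<Rightarrow> nat \<Rightarrow> real mat" where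
  "select_first \<tau> L n = mat (\<tau> * n) (L * n) (\<lambda>(i, j). if i = j then 1 else 0)"

definition mat_V :: "nat \<Rightarrow> nat \<Rightarrow> nat \<Rightarrow> nat \<Rightarrow> real mat" where
  "mat_V \<tau> L nu ny = diag_block_mat [select_first \<tau> L nu, select_first \<tau> L ny]"

definition mat_F1 ::
  "nat \<Rightarrow> nat \<Rightarrow> nat \<Rightarrow> nat \<Rightarrow> nat \<Rightarrow> (nat \<Rightarrow> real vec) \<Rightarrow> (nat \<Rightarrow> real vec) \<Rightarrow> real mat" where
  "mat_F1 \<tau> L N nu ny u y = mat_V \<tau> L nu ny * mat_F5 L N nu ny u y"

definition mat_F3 ::
  "nat \<Rightarrow> nat \<Rightarrow> nat \<Rightarrow> nat \<Rightarrow> nat \<Rightarrow> nat \<Rightarrow>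
   (nat \<Rightarrow> real vec) \<Rightarrow> (nat \<Rightarrow> real vec) \<Rightarrow> (nat \<Rightarrow> real vec) \<Rightarrow> real mat" where
  "mat_F3 \<tau> L N nu np ny u p y =
    mat_F1 \<tau> L N nu ny u y @\<^sub>r
    hankel L N (np * nu) (\<lambda>k. kron_vec (p k) (u k)) @\<^sub>r
    hankel L N (np * ny) (\<lambda>k. kron_vec (p k) (y k))"

definition mat_F4 :: "nat \<Rightarrow> nat \<Rightarrow> nat \<Rightarrow> nat \<Rightarrow> nat \<Rightarrow> real mat" where
  "mat_F4 \<tau> L nu np ny =
    0\<^sub>m (\<tau> * nu + \<tau> * ny) (L * (np * nu) + L * (np * ny)) @\<^sub>r
    diag_block_mat [1\<^sub>m (L * (np * nu)), 1\<^sub>m (L * (np * ny))]"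

text \<open>A scheduling trajectory of length \<open>L\<close> is a list, so that its \<open>k\<close>-th entry (counted from
  \<open>1\<close>) is \<open>ps ! (k - 1)\<close>.\<close>

definition sched_mat :: "nat \<Rightarrow> real vec list \<Rightarrow> real mat" where
  "sched_mat n ps = diag_block_mat (map (\<lambda>q. kron_mat (col_mat q) (1\<^sub>m n)) ps)"

definition sched_mat_uy :: "nat \<Rightarrow> nat \<Rightarrow> real vec list \<Rightarrow> real mat" where
  "sched_mat_uy nu ny ps = diag_block_mat [sched_mat nu ps, sched_mat ny ps]"

definition mat_F ::
  "nat \<Rightarrow> nat \<Rightarrow> nat \<Rightarrow> nat \<Rightarrow> nat \<Rightarrow> nat \<Rightarrow>
   (nat \<Rightarrow> real vec) \<Rightarrow> (nat \<Rightarrow> real vec) \<Rightarrow> (nat \<Rightarrow> real vec) \<Rightarrow> real vec list \<Rightarrow> real mat" where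
  "mat_F \<tau> L N nu np ny u p y ps =
    mat_F3 \<tau> L N nu np ny u p y -
    mat_F4 \<tau> L nu np ny * sched_mat_uy nu ny ps * mat_F5 L N nu ny u y"

section \<open>Quadratic description of scheduling trajectories and matrix inequality\<close>

definition quadratic_sched_set ::
  "nat \<Rightarrow> nat \<Rightarrow> nat \<Rightarrow> real vec set \<Rightarrow> real mat \<Rightarrow> real vec list set" where
  "quadratic_sched_set L nu ny PP MP = {ps. length ps = L \<and> set ps \<subseteq> PP \<and>
    (let Z = sched_mat_uy nu ny ps @\<^sub>r 1\<^sub>m (L * nu + L * ny)
     in psd_mat (L * nu + L * ny) (transpose_mat Z * MP * Z))}"

definition lmi_mat :: "real mat \<Rightarrow> real mat \<Rightarrow> real mat \<Rightarrow> real mat \<Rightarrow> real mat \<Rightarrow>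
    real \<Rightarrow> real \<Rightarrow> real mat" where
  "lmi_mat F3 F4 F5 PiH MP \<mu> l =
    (let D = diag_block_mat [1\<^sub>m (dim_col F4), F5]
     in four_block_mat
          (\<mu> \<cdot>\<^sub>m (transpose_mat F4 * F4)) (- \<mu> \<cdot>\<^sub>m (transpose_mat F4 * F3))
          (- \<mu> \<cdot>\<^sub>m (transpose_mat F3 * F4)) (\<mu> \<cdot>\<^sub>m (transpose_mat F3 * F3) + PiH)
        - l \<cdot>\<^sub>m (transpose_mat D * MP * D))"

end

theory Submission
  imports Defs
begin

text \<open>Given \<open>g\<close> with \<open>F(p) g = 0\<close>, evaluate the quadratic form of the matrix inequality at the
  stacked vector \<open>(z, g)\<close>, where \<open>z\<close> is the image of \<open>F\<^sub>5 g\<close> under the scheduling matrix of \<open>p\<close>.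
  Since \<open>F\<^sub>4 z = F\<^sub>3 g\<close>, the terms with \<open>\<mu>\<close> vanish. The term with \<open>\<lambda>\<close> is the quadratic form that
  describes the scheduling trajectories, taken at \<open>F\<^sub>5 g\<close>, so it is nonnegative (S-procedure).\<close>

lemma smult_mat_mult_vec:
  fixes A :: "'a :: comm_ring_1 mat"
  assumes "A \<in> carrier_mat nr nc" "x \<in> carrier_vec nc"
  shows "(c \<cdot>\<^sub>m A) *\<^sub>v x = c \<cdot>\<^sub>v (A *\<^sub>v x)"
  using assms by (intro eq_vecI) auto

text \<open>The transpose is the adjoint for the scalar product, so the outer factor moves onto the
  left argument. Both congruences are evaluated this way: that of the multiplier term in the matrix
  inequality, and that of the stack of \<open>P\<close> over the identity in the scheduling
  constraint.\<close>

lemma quadratic_form_congruence: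
  fixes A M :: "'a :: comm_ring_1 mat"
  assumes A: "A \<in> carrier_mat nr nc" and M: "M \<in> carrier_mat nr nr" and x: "x \<in> carrier_vec nc"
  shows "x \<bullet> ((transpose_mat A * M * A) *\<^sub>v x) = (A *\<^sub>v x) \<bullet> (M *\<^sub>v (A *\<^sub>v x))"
proof -
  have Ax: "A *\<^sub>v x \<in> carrier_vec nr" and At: "transpose_mat A \<in> carrier_mat nc nr"
    using A x by auto
  have MAx: "M *\<^sub>v (A *\<^sub>v x) \<in> carrier_vec nr"
    using M Ax by auto
  have "(transpose_mat A * M * A) *\<^sub>v x = transpose_mat A *\<^sub>v (M *\<^sub>v (A *\<^sub>v x))"
    by (simp only: assoc_mult_mat_vec[OF mult_carrier_mat[OF At M] A x]
        assoc_mult_mat_vec[OF At M Ax])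
  then have "x \<bullet> ((transpose_mat A * M * A) *\<^sub>v x) = (transpose_mat A *\<^sub>v (M *\<^sub>v (A *\<^sub>v x))) \<bullet> x"
    using At MAx x by (simp add: comm_scalar_prod[of _ nc])
  also have "\<dots> = (M *\<^sub>v (A *\<^sub>v x)) \<bullet> (A *\<^sub>v x)"
    by (rule transpose_vec_mult_scalar[OF A x MAx])
  finally show ?thesis
    using comm_scalar_prod[OF MAx Ax] by simp
qed

lemma diag_block_mat_pair_mult_vec:
  fixes A B :: "'a :: comm_ring_1 mat"
  assumes A: "A \<in> carrier_mat nr1 nc1" and B: "B \<in> carrier_mat nr2 nc2"
    and x: "x \<in> carrier_vec nc1" and y: "y \<in> carrier_vec nc2"
  shows "diag_block_mat [A, B] *\<^sub>v (x @\<^sub>v y) = (A *\<^sub>v x) @\<^sub>v (B *\<^sub>v y)"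
proof -
  \<comment> \<open>The recursion of \<open>diag_block_mat\<close> ends in an empty 0 by 0 block,
    which is absorbed here so that the pair becomes a plain \<open>four_block_mat\<close>.\<close>
  have B': "diag_block_mat [B] = B"
    by (rule eq_matI) (auto simp: Let_def)
  have "diag_block_mat [A, B] = four_block_mat A (0\<^sub>m nr1 nc2) (0\<^sub>m nr2 nc1) B"
    using A B B' by (auto simp: Let_def)
  then have "diag_block_mat [A, B] *\<^sub>v (x @\<^sub>v y) =
      (A *\<^sub>v x + 0\<^sub>m nr1 nc2 *\<^sub>v y) @\<^sub>v (0\<^sub>m nr2 nc1 *\<^sub>v x + B *\<^sub>v y)"
    using four_block_mat_mult_vec[OF A _ _ B x y, of "0\<^sub>m nr1 nc2" "0\<^sub>m nr2 nc1"] by simp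
  moreover have "0\<^sub>m nr1 nc2 *\<^sub>v y = 0\<^sub>v nr1" "0\<^sub>m nr2 nc1 *\<^sub>v x = 0\<^sub>v nr2"
    using x y by auto
  ultimately show ?thesis
    using A B x y by simp
qed

lemma diag_block_mat_pair_carrier:
  assumes "A \<in> carrier_mat nr1 nc1" and "B \<in> carrier_mat nr2 nc2"
  shows "diag_block_mat [A, B] \<in> carrier_mat (nr1 + nr2) (nc1 + nc2)"
  using assms by (auto simp: dim_diag_block_mat)

text \<open>The part of the form with \<mu> is \<mu> times the squared Euclidean length of
  \<open>F4 z - F3 g\<close>, which \<open>eq\<close> makes zero whatever the sign of \<mu>.\<close>

lemma lmi_quadratic_form:
  fixes F3 F4 F5 PiH MP :: "real mat"
  assumes F3: "F3 \<in> carrier_mat m n" and F4: "F4 \<in> carrier_mat m k"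
    and F5: "F5 \<in> carrier_mat q n" and PiH: "PiH \<in> carrier_mat n n"
    and MP: "MP \<in> carrier_mat (k + q) (k + q)"
    and z: "z \<in> carrier_vec k" and g: "g \<in> carrier_vec n"
    and eq: "F4 *\<^sub>v z = F3 *\<^sub>v g"
  shows "(z @\<^sub>v g) \<bullet> (lmi_mat F3 F4 F5 PiH MP \<mu> l *\<^sub>v (z @\<^sub>v g)) =
    g \<bullet> (PiH *\<^sub>v g) - l * ((z @\<^sub>v (F5 *\<^sub>v g)) \<bullet> (MP *\<^sub>v (z @\<^sub>v (F5 *\<^sub>v g))))"
proof -
  define D where "D = diag_block_mat [1\<^sub>m k, F5]"
  define E where "E = transpose_mat D * MP * D"
  define B where "B = four_block_mat
    (\<mu> \<cdot>\<^sub>m (transpose_mat F4 * F4)) (- \<mu> \<cdot>\<^sub>m (transpose_mat F4 * F3))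
    (- \<mu> \<cdot>\<^sub>m (transpose_mat F3 * F4)) (\<mu> \<cdot>\<^sub>m (transpose_mat F3 * F3) + PiH)"
  let ?x = "z @\<^sub>v g"
  have lmi: "lmi_mat F3 F4 F5 PiH MP \<mu> l = B - l \<cdot>\<^sub>m E"
    using F4 by (simp only: lmi_mat_def Let_def B_def E_def D_def carrier_matD)
  have D: "D \<in> carrier_mat (k + q) (k + n)"
    unfolding D_def by (rule diag_block_mat_pair_carrier[OF one_carrier_mat F5])
  have E: "E \<in> carrier_mat (k + n) (k + n)"
    using D MP unfolding E_def by auto
  have x: "?x \<in> carrier_vec (k + n)"
    using z g by simp
  have blocks: "\<mu> \<cdot>\<^sub>m (transpose_mat F4 * F4) \<in> carrier_mat k k"
    "- \<mu> \<cdot>\<^sub>m (transpose_mat F4 * F3) \<in> carrier_mat k n"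
    "- \<mu> \<cdot>\<^sub>m (transpose_mat F3 * F4) \<in> carrier_mat n k"
    "\<mu> \<cdot>\<^sub>m (transpose_mat F3 * F3) + PiH \<in> carrier_mat n n"
    using F3 F4 PiH by auto
  have B: "B \<in> carrier_mat (k + n) (k + n)"
    unfolding B_def using blocks by auto
  let ?v = "F3 *\<^sub>v g"
  let ?a = "transpose_mat F4 *\<^sub>v ?v" and ?b = "transpose_mat F3 *\<^sub>v ?v"
  have a: "?a \<in> carrier_vec k" and b: "?b \<in> carrier_vec n" and c: "PiH *\<^sub>v g \<in> carrier_vec n"
    using F3 F4 PiH g by auto
  have F4t: "transpose_mat F4 \<in> carrier_mat k m" and F3t: "transpose_mat F3 \<in> carrier_mat n m"
    using F3 F4 by auto
  \<comment> \<open>Replacing \<open>F4 z\<close> by \<open>F3 g\<close> turns all four blocks into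
    multiples of \<open>?a\<close> or \<open>?b\<close> with opposite signs in each row. Hence the
    \<mu> terms cancel already in the vector \<open>B (z, g)\<close>, before the scalar product is
    taken.\<close>
  have "(\<mu> \<cdot>\<^sub>m (transpose_mat F4 * F4)) *\<^sub>v z = \<mu> \<cdot>\<^sub>v ?a"
    using smult_mat_mult_vec[OF mult_carrier_mat[OF F4t F4] z] assoc_mult_mat_vec[OF F4t F4 z] eq
    by simp
  moreover have "(- \<mu> \<cdot>\<^sub>m (transpose_mat F4 * F3)) *\<^sub>v g = - \<mu> \<cdot>\<^sub>v ?a"
    using smult_mat_mult_vec[OF mult_carrier_mat[OF F4t F3] g] assoc_mult_mat_vec[OF F4t F3 g]
    by simp
  moreover have "(- \<mu> \<cdot>\<^sub>m (transpose_mat F3 * F4)) *\<^sub>v z = - \<mu> \<cdot>\<^sub>v ?b"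
    using smult_mat_mult_vec[OF mult_carrier_mat[OF F3t F4] z] assoc_mult_mat_vec[OF F3t F4 z] eq
    by simp
  moreover have "(\<mu> \<cdot>\<^sub>m (transpose_mat F3 * F3) + PiH) *\<^sub>v g = \<mu> \<cdot>\<^sub>v ?b + PiH *\<^sub>v g"
    using smult_mat_mult_vec[OF mult_carrier_mat[OF F3t F3] g] assoc_mult_mat_vec[OF F3t F3 g]
      add_mult_distrib_mat_vec[OF smult_carrier_mat[OF mult_carrier_mat[OF F3t F3]] PiH g]
    by simp
  \<comment> \<open>Keeping the entries of \<open>?a\<close> and \<open>?b\<close> folded leaves a
    cancellation of equal scalars instead of sums over rows.\<close>
  moreover have "\<mu> \<cdot>\<^sub>v ?a + - \<mu> \<cdot>\<^sub>v ?a = 0\<^sub>v k"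
    using a F4 by (intro eq_vecI) (simp_all del: index_mult_mat_vec)
  moreover have "- \<mu> \<cdot>\<^sub>v ?b + (\<mu> \<cdot>\<^sub>v ?b + PiH *\<^sub>v g) = PiH *\<^sub>v g"
    using b c F3 PiH by (intro eq_vecI) (simp_all del: index_mult_mat_vec)
  ultimately have Bx: "B *\<^sub>v ?x = 0\<^sub>v k @\<^sub>v (PiH *\<^sub>v g)"
    unfolding B_def four_block_mat_mult_vec[OF blocks z g] by simp
  have xBx: "?x \<bullet> (B *\<^sub>v ?x) = g \<bullet> (PiH *\<^sub>v g)"
    unfolding Bx scalar_prod_append[OF z g zero_carrier_vec c] using z by simp
  \<comment> \<open>\<open>D\<close> leaves \<open>z\<close> alone and sends \<open>g\<close> to
    \<open>F5 g\<close>, so the form of \<open>E\<close> at \<open>(z, g)\<close> is that of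
    \<open>MP\<close> at \<open>(z, F5 g)\<close>.\<close>
  have Dx: "D *\<^sub>v ?x = z @\<^sub>v (F5 *\<^sub>v g)"
    unfolding D_def diag_block_mat_pair_mult_vec[OF one_carrier_mat F5 z g] using z by simp
  have "?x \<bullet> ((B - l \<cdot>\<^sub>m E) *\<^sub>v ?x) = ?x \<bullet> (B *\<^sub>v ?x) - l * (?x \<bullet> (E *\<^sub>v ?x))"
    using B E x
    by (simp add: minus_mult_distrib_mat_vec[OF B smult_carrier_mat[OF E] x] smult_mat_mult_vec[OF E x]
        scalar_prod_minus_distrib[of _ "k + n"])
  then show ?thesis
    unfolding lmi xBx E_def quadratic_form_congruence[OF D MP x] Dx .
qed

text \<open>The S-procedure step for arbitrary matrices of matching sizes: the form of
  \<open>PiH\<close> at \<open>g\<close> is the form of the matrix inequality plus \<open>l\<close>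
  times the form of \<open>MP\<close>, and both summands are nonnegative.\<close>

lemma lmi_imp_nonneg_on_kernel:
  fixes F3 F4 F5 P PiH MP :: "real mat"
  assumes F3: "F3 \<in> carrier_mat m n" and F4: "F4 \<in> carrier_mat m k"
    and F5: "F5 \<in> carrier_mat q n" and P: "P \<in> carrier_mat k q"
    and PiH: "PiH \<in> carrier_mat n n" and MP: "MP \<in> carrier_mat (k + q) (k + q)"
    and l: "0 \<le> l" and lmi: "psd_mat (k + n) (lmi_mat F3 F4 F5 PiH MP \<mu> l)"
    and sched: "psd_mat q (transpose_mat (P @\<^sub>r 1\<^sub>m q) * MP * (P @\<^sub>r 1\<^sub>m q))"
    and g: "g \<in> carrier_vec n" and ker: "(F3 - F4 * P * F5) *\<^sub>v g = 0\<^sub>v m"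
  shows "0 \<le> g \<bullet> (PiH *\<^sub>v g)"
proof -
  define w where "w = F5 *\<^sub>v g"
  \<comment> \<open>This choice serves two ends: the kernel condition becomes
    \<open>F4 z = F3 g\<close>, and \<open>(z, w)\<close> is the image of \<open>w\<close> under
    \<open>P\<close> stacked over the identity.\<close>
  define z where "z = P *\<^sub>v w"
  have w: "w \<in> carrier_vec q" and z: "z \<in> carrier_vec k"
    unfolding z_def w_def using F5 P g by auto
  have F4P: "F4 * P \<in> carrier_mat m q" and F4PF5: "F4 * P * F5 \<in> carrier_mat m n"
    using F4 P F5 by auto
  have u: "F3 *\<^sub>v g \<in> carrier_vec m" and v: "F4 *\<^sub>v z \<in> carrier_vec m"
    using F3 F4 g z by auto
  have "F3 *\<^sub>v g - F4 *\<^sub>v z = 0\<^sub>v m"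
    using ker minus_mult_distrib_mat_vec[OF F3 F4PF5 g] assoc_mult_mat_vec[OF F4P F5 g]
      assoc_mult_mat_vec[OF F4 P w] by (simp add: z_def w_def)
  then have eq: "F4 *\<^sub>v z = F3 *\<^sub>v g"
    \<comment> \<open>Since the zero vector depends on the dimension, the vanishing difference is
      turned into equality entry by entry.\<close>
    using u v by (metis carrier_vecD eq_iff_diff_eq_0 eq_vecI index_minus_vec(1) index_zero_vec(1))
  let ?Z = "P @\<^sub>r 1\<^sub>m q"
  have Z: "?Z \<in> carrier_mat (k + q) q"
    by (rule carrier_append_rows[OF P one_carrier_mat])
  have Zw: "?Z *\<^sub>v w = z @\<^sub>v w"
    unfolding mat_mult_append[OF P one_carrier_mat w] z_def using w by simp
  have "0 \<le> w \<bullet> ((transpose_mat ?Z * MP * ?Z) *\<^sub>v w)"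
    using sched w by (simp add: psd_mat_def)
  \<comment> \<open>The sign of \<open>l\<close> enters here: scaling by it must preserve the
    inequality from the scheduling constraint.\<close>
  then have "0 \<le> l * ((z @\<^sub>v w) \<bullet> (MP *\<^sub>v (z @\<^sub>v w)))"
    using l unfolding quadratic_form_congruence[OF Z MP w] Zw by simp
  moreover have "0 \<le> (z @\<^sub>v g) \<bullet> (lmi_mat F3 F4 F5 PiH MP \<mu> l *\<^sub>v (z @\<^sub>v g))"
    using lmi z g by (simp add: psd_mat_def)
  ultimately show ?thesis
    unfolding lmi_quadratic_form[OF F3 F4 F5 PiH MP z g eq] w_def by simp
qed

text \<open>Block heights are read off from the entries of \<open>ps\<close>: a column of dimension
  \<open>np\<close> gives a block of size \<open>np * n\<close> by \<open>n\<close>, and sizes add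
  along the diagonal.\<close>

lemma sched_mat_carrier:
  assumes "set ps \<subseteq> carrier_vec np"
  shows "sched_mat n ps \<in> carrier_mat (length ps * (np * n)) (length ps * n)"
  using assms
  by (induction ps)
    (auto simp: sched_mat_def Let_def kron_mat_def col_mat_def dim_diag_block_mat)

lemma mat_F5_carrier: "mat_F5 L N nu ny u y \<in> carrier_mat (L * nu + L * ny) (N - L + 1)"
  unfolding mat_F5_def hankel_def by (intro carrier_append_rows mat_carrier)

lemma mat_PiH_carrier: "mat_PiH L N nu ny u y Q S R \<in> carrier_mat (N - L + 1) (N - L + 1)"
  using mat_F5_carrier[of L N nu ny u y] by (auto simp: mat_PiH_def)

text \<open>The row count is bracketed exactly as for \<open>mat_F4\<close>, so that both
  instantiate the same \<open>m\<close> in the kernel lemma.\<close>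

lemma mat_F3_carrier:
  "mat_F3 \<tau> L N nu np ny u p y \<in>
    carrier_mat (\<tau> * nu + \<tau> * ny + (L * (np * nu) + L * (np * ny))) (N - L + 1)"
proof -
  have "mat_V \<tau> L nu ny \<in> carrier_mat (\<tau> * nu + \<tau> * ny) (L * nu + L * ny)"
    unfolding mat_V_def select_first_def by (intro diag_block_mat_pair_carrier mat_carrier)
  then have "mat_F1 \<tau> L N nu ny u y \<in> carrier_mat (\<tau> * nu + \<tau> * ny) (N - L + 1)"
    unfolding mat_F1_def using mat_F5_carrier by (rule mult_carrier_mat)
  then show ?thesis
    unfolding mat_F3_def hankel_def by (intro carrier_append_rows mat_carrier)
qed

lemma mat_F4_carrier:
  "mat_F4 \<tau> L nu np ny \<in>
    carrier_mat (\<tau> * nu + \<tau> * ny + (L * (np * nu) + L * (np * ny)))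
      (L * (np * nu) + L * (np * ny))"
  unfolding mat_F4_def
  by (intro carrier_append_rows zero_carrier_mat diag_block_mat_pair_carrier one_carrier_mat)

theorem proposition4:
  fixes L N \<tau> nu np ny na nb :: nat
    and u p y :: "nat \<Rightarrow> real vec"
    and a b :: "nat \<Rightarrow> real vec \<Rightarrow> real mat"
    and PP :: "real vec set"
    and Q S R MP :: "real mat"
    and Psched :: "real vec list set"
    and pnom :: "real vec list"
    and nrmW :: "real vec \<Rightarrow> real"
    and pmax :: real
  assumes "1 \<le> L" and "L < N" and "1 \<le> \<tau>" and "\<tau> < L"
    and "PP \<subseteq> carrier_vec np" and "convex_vecs PP" and "compact_vecs np PP"
    and "\<forall>k\<in>{1..N}. u k \<in> carrier_vec nu \<and> p k \<in> PP \<and> y k \<in> carrier_vec ny"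
    and "\<forall>i\<in>{1..na}. affine_mat_fun np ny ny (a i)"
    and "\<forall>i\<in>{0..nb}. affine_mat_fun np ny nu (b i)"
    and "lpv_data na nb a b ny N u p y"
    and "symmetric_mat nu Q" and "S \<in> carrier_mat nu ny" and "symmetric_mat ny R"
    and "norm_on_vecs np nrmW" and "0 < pmax"
    and "length pnom = L" and "set pnom \<subseteq> carrier_vec np"
    and "\<forall>ps\<in>Psched. \<forall>k<L. nrmW (ps ! k - pnom ! k) \<le> pmax"
    and "symmetric_mat (L * (np * nu) + L * (np * ny) + (L * nu + L * ny)) MP"
    and "Psched = quadratic_sched_set L nu ny PP MP"
    and "\<exists>\<mu> l. 0 \<le> l \<and>
      psd_mat (L * (np * nu) + L * (np * ny) + (N - L + 1))
        (lmi_mat (mat_F3 \<tau> L N nu np ny u p y) (mat_F4 \<tau> L nu np ny) (mat_F5 L N nu ny u y)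
          (mat_PiH L N nu ny u y Q S R) MP \<mu> l)"
  shows "\<forall>ps\<in>Psched. \<forall>g\<in>carrier_vec (N - L + 1).
    mat_F \<tau> L N nu np ny u p y ps *\<^sub>v g
      = 0\<^sub>v (\<tau> * nu + \<tau> * ny + L * (np * nu) + L * (np * ny)) \<longrightarrow>
    0 \<le> g \<bullet> (mat_PiH L N nu ny u y Q S R *\<^sub>v g)"
proof (intro ballI impI)
  fix ps g
  assume ps: "ps \<in> Psched" and g: "g \<in> carrier_vec (N - L + 1)"
    and ker: "mat_F \<tau> L N nu np ny u p y ps *\<^sub>v g
      = 0\<^sub>v (\<tau> * nu + \<tau> * ny + L * (np * nu) + L * (np * ny))"
  obtain \<mu> l where l: "0 \<le> l"
    and lmi: "psd_mat (L * (np * nu) + L * (np * ny) + (N - L + 1))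
      (lmi_mat (mat_F3 \<tau> L N nu np ny u p y) (mat_F4 \<tau> L nu np ny) (mat_F5 L N nu ny u y)
        (mat_PiH L N nu ny u y Q S R) MP \<mu> l)"
    using assms(22) by blast
  let ?q = "L * nu + L * ny" and ?P = "sched_mat_uy nu ny ps"
  have MP: "MP \<in> carrier_mat (L * (np * nu) + L * (np * ny) + ?q)
      (L * (np * nu) + L * (np * ny) + ?q)"
    using assms(20) by (simp add: symmetric_mat_def)
  \<comment> \<open>Membership in \<open>PP\<close> fixes the dimension of every entry of
    \<open>ps\<close>; together with the length this determines the size of
    \<open>?P\<close>.\<close>
  have len: "length ps = L" and car: "set ps \<subseteq> carrier_vec np"
    and sched: "psd_mat ?q (transpose_mat (?P @\<^sub>r 1\<^sub>m ?q) * MP * (?P @\<^sub>r 1\<^sub>m ?q))"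
    using ps assms(5,21) by (auto simp: quadratic_sched_set_def Let_def)
  have P: "?P \<in> carrier_mat (L * (np * nu) + L * (np * ny)) ?q"
    unfolding sched_mat_uy_def
    using diag_block_mat_pair_carrier[OF sched_mat_carrier[OF car] sched_mat_carrier[OF car]]
    by (simp only: len)
  show "0 \<le> g \<bullet> (mat_PiH L N nu ny u y Q S R *\<^sub>v g)"
    \<comment> \<open>Unfolding \<open>mat_F\<close> gives the required kernel condition up to the
      bracketing of the row count, which \<open>add.assoc\<close> settles.\<close>
    using ker
    by (intro lmi_imp_nonneg_on_kernel[OF mat_F3_carrier mat_F4_carrier mat_F5_carrier P
          mat_PiH_carrier MP l lmi sched g])
      (simp add: mat_F_def add.assoc)
qed

end
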